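(* As formal power series in $x$, $$\sum_{n\ge0} \left|\mathcal{IC}(\mathfrak{B}_n)\right|\, x^n=\frac{4-10x+8x^2}{2-11x+14x^2-8x^3+(2-3x)\sqrt{1-4x}}.$$
   Context: For a finite poset $P$, a subset $I\subseteq P$ is an interval-closed set if for all $a,b\in I$ and $z\in P$ with $a<z<b$ we have $z\in I$; $\mathcal{IC}(P)$ is the set of all interval-closed sets of $P$ (including the empty set). $\mathfrak{B}_n$ is the type $B_n$ minuscule poset, i.e. the triangular poset that is (the left) half of the diamond $[n]\times[n]$, including the central vertical file: $\mathfrak{B}_n=\{(a,b): 1\le a\le b\le n\}$ with the order $(a,b)\le(c,d)$ iff $a\le c$ and $b\le d$. $\mathfrak{B}_0$ is the empty poset, which has exactly one ICS. Equivalently, interval-closed sets of $\mathfrak{B}_n$ correspond to interval-closed sets of $[n]\times[n]$ invariant under $(a,b)\mapsto(b,a)$. The square root denotes the formal power series with constant term $1$. *)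

theory Defs
  imports
    Complex_Main
    "HOL-Library.Product_Order"
    "HOL-Computational_Algebra.Formal_Power_Series"
begin

(* A poset is given as a set P of elements of an order type, with the induced order. *)
definition interval_closed_sets :: "'a::order set \<Rightarrow> 'a set set" where
  "interval_closed_sets P =
     {I. I \<subseteq> P \<and> (\<forall>a\<in>I. \<forall>b\<in>I. \<forall>z\<in>P. a < z \<and> z < b \<longrightarrow> z \<in> I)}"

(* The order on pairs is the componentwise one of Product_Order, not the lexicographic one. *)
definition minuscule_B :: "nat \<Rightarrow> (nat \<times> nat) set" where
  "minuscule_B n = {(a, b). 1 \<le> a \<and> a \<le> b \<and> b \<le> n}"

(* fps_radical root 2 f takes root 2 of the constant term of f; here that is root 2 1 = 1,
   so this is the square root of 1 - 4x with constant term 1. *)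
definition sqrt_1_minus_4x :: "real fps" where
  "sqrt_1_minus_4x = fps_radical root 2 (1 - 4 * fps_X)"

lemma sqrt_1_minus_4x_square: "sqrt_1_minus_4x ^ 2 = 1 - 4 * fps_X"
  using power_radical[of "1 - 4 * fps_X :: real fps" root 1]
  by (simp add: sqrt_1_minus_4x_def numeral_2_eq_2 fps_numeral_nth)

lemma sqrt_1_minus_4x_nth_0: "fps_nth sqrt_1_minus_4x 0 = 1"
  by (simp add: sqrt_1_minus_4x_def)

end

theory Submission
  imports Defs
begin

text \<open>
  An interval-closed set \<open>I\<close> is a difference \<open>J - K\<close> of nested order ideals. Several pairs may
  give the same \<open>I\<close>, but exactly one of them has for \<open>J\<close> the down-closure of \<open>I\<close>; it is singled out by
  the condition that no maximal element of \<open>J\<close> lies in \<open>K\<close>. Counting interval-closed sets thus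
  becomes counting such tight pairs (\<open>bij_betw_tight_ideal_pairs\<close>).

  Cut the triangle into its files \<open>{(a, a + n - k) | 1 \<le> a \<le> k}\<close> for \<open>k = 1, ..., n\<close>, from the
  corner \<open>(1, n)\<close> to the central file. An order ideal meets the \<open>k\<close>-th file in an initial segment,
  of some height \<open>h k\<close>, and the ideal property says precisely that \<open>h (k + 1) - h k\<close> is \<open>0\<close> or
  \<open>1\<close>. Hence ideals are the same as 0/1-words of length \<open>n\<close>, nested ideals are pairs of words
  such that the path of one stays weakly below the path of the other, and the maximal elements of
  \<open>J\<close> are the peaks of its path (an up step followed by a flat step or by the end). Tightness requires the lower path to be strictly
  below the upper one at each peak of the latter (\<open>tight_iff_peaks\<close>).

  Reading both words simultaneously, all that matters is the distance \<open>d\<close> of the two paths and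
  whether the upper path has just gone up (\<open>admissible_iff\<close>), and the latter only when \<open>d = 0\<close>.
  Let \<open>G\<^sub>d\<close> count the ways to continue from distance \<open>d\<close>, with \<open>U\<close> for distance \<open>0\<close> just after
  an up step. Then
  \<open>G\<^sub>0 = 1 + x (G\<^sub>0 + U + G\<^sub>1)\<close>, \<open>U = x (U + G\<^sub>1)\<close>, and
  \<open>G\<^sub>d = 1 + x (G\<^bsub>d+1\<^esub> + 2 G\<^sub>d + G\<^bsub>d-1\<^esub>)\<close> for \<open>d \<ge> 1\<close>.
  The last system is a linear recurrence in \<open>d\<close> with constant solution \<open>1 / (1 - 4 x)\<close> and
  characteristic equation \<open>r = x (1 + r)\<^sup>2\<close>. Its root with zero constant term is
  \<open>r = (1 - s) / (1 + s)\<close>, where \<open>s\<close> is the square root of \<open>1 - 4 x\<close>, and so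
  \<open>G\<^sub>d = 1 / s\<^sup>2 + r\<^sup>d (G\<^sub>0 - 1 / s\<^sup>2)\<close>. Taking \<open>d = 1\<close> closes the system (\<open>gf_one_eq\<close>), and
  \<open>G\<^sub>0\<close> is the generating function in question.
\<close>

section \<open>Interval-closed sets as differences of order ideals\<close>

definition order_ideals :: "'a::order set \<Rightarrow> 'a set set" where
  "order_ideals P = {J. J \<subseteq> P \<and> (\<forall>x\<in>J. \<forall>y\<in>P. y \<le> x \<longrightarrow> y \<in> J)}"

text \<open>
  The last condition keeps the maximal elements of \<open>J\<close> in \<open>J - K\<close>. For finite \<open>P\<close> this means that
  \<open>J\<close> is the smallest order ideal containing \<open>J - K\<close>.
\<close>
definition tight_ideal_pairs :: "'a::order set \<Rightarrow> ('a set \<times> 'a set) set" where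
  "tight_ideal_pairs P =
     {(K, J). K \<in> order_ideals P \<and> J \<in> order_ideals P \<and> K \<subseteq> J \<and>
              (\<forall>x\<in>J. (\<forall>y\<in>J. \<not> x < y) \<longrightarrow> x \<notin> K)}"

text \<open>
  Every element of the finite set \<open>J\<close> lies below a maximal one, and tightness puts that one outside
  \<open>K\<close>. So \<open>J\<close>, and then \<open>K\<close>, can be recovered from the difference \<open>J - K\<close>.
\<close>
lemma tight_ideal_pair_down_closure:
  assumes "finite P" and "(K, J) \<in> tight_ideal_pairs P"
  shows "J = {y \<in> P. \<exists>x\<in>J - K. y \<le> x}"
proof (intro equalityI subsetI)
  fix y assume y: "y \<in> J"
  have J: "J \<in> order_ideals P" and tight: "\<forall>x\<in>J. (\<forall>y\<in>J. \<not> x < y) \<longrightarrow> x \<notin> K"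
    using assms(2) by (auto simp: tight_ideal_pairs_def)
  then have "finite J" using assms(1) by (auto simp: order_ideals_def intro: finite_subset)
  then obtain x where x: "x \<in> J" "y \<le> x" "\<forall>z\<in>J. x \<le> z \<longrightarrow> x = z"
    using finite_has_maximal2[OF _ y] by metis
  then have "x \<notin> K" using tight by (metis order_less_imp_le order_less_irrefl)
  then show "y \<in> {y \<in> P. \<exists>x\<in>J - K. y \<le> x}"
    using x y J by (auto simp: order_ideals_def)
next
  fix y assume "y \<in> {y \<in> P. \<exists>x\<in>J - K. y \<le> x}"
  then show "y \<in> J" using assms(2) by (auto simp: tight_ideal_pairs_def order_ideals_def)
qed

text \<open>
  The inverse map sends \<open>I\<close> to \<open>(J - I, J)\<close> with \<open>J\<close> the down-closure of \<open>I\<close>. That \<open>J - I\<close> is an order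
  ideal is exactly interval-closedness: an element of \<open>J - I\<close> has some element of \<open>I\<close> above it, so it
  cannot also have one below it.
\<close>
lemma bij_betw_tight_ideal_pairs:
  assumes "finite P"
  shows "bij_betw (\<lambda>(K, J). J - K) (tight_ideal_pairs P) (interval_closed_sets P)"
proof (rule bij_betw_imageI)
  show "inj_on (\<lambda>(K, J). J - K) (tight_ideal_pairs P)"
  proof (rule inj_onI)
    fix q q'
    assume q: "q \<in> tight_ideal_pairs P" "q' \<in> tight_ideal_pairs P"
      and "(\<lambda>(K, J). J - K) q = (\<lambda>(K, J). J - K) q'"
    moreover obtain K J K' J' where qq: "q = (K, J)" "q' = (K', J')" by (metis surj_pair)
    ultimately have KJ: "(K, J) \<in> tight_ideal_pairs P" "(K', J') \<in> tight_ideal_pairs P"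
      and eq: "J - K = J' - K'" by simp_all
    have "J = J'"
      using tight_ideal_pair_down_closure[OF assms KJ(1)]
        tight_ideal_pair_down_closure[OF assms KJ(2)] eq by metis
    moreover have "K \<subseteq> J" "K' \<subseteq> J'" using KJ by (auto simp: tight_ideal_pairs_def)
    ultimately show "q = q'" using eq qq by blast
  qed
  show "(\<lambda>(K, J). J - K) ` tight_ideal_pairs P = interval_closed_sets P"
  proof (intro equalityI subsetI)
    fix I assume "I \<in> (\<lambda>(K, J). J - K) ` tight_ideal_pairs P"
    then obtain K J where I: "I = J - K" and KJ: "(K, J) \<in> tight_ideal_pairs P"
      by (auto simp: image_iff)
    have P: "J \<subseteq> P"
      and J: "\<And>x y. x \<in> J \<Longrightarrow> y \<in> P \<Longrightarrow> y \<le> x \<Longrightarrow> y \<in> J"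
      and K: "\<And>x y. x \<in> K \<Longrightarrow> y \<in> P \<Longrightarrow> y \<le> x \<Longrightarrow> y \<in> K"
      using KJ by (auto simp: tight_ideal_pairs_def order_ideals_def)
    have "z \<in> I" if "a \<in> I" "b \<in> I" "z \<in> P" "a < z" "z < b" for a b z
    proof -
      have "z \<in> J" using J[of b z] that by (simp add: I order_less_imp_le)
      moreover have "z \<notin> K" using K[of z a] that P by (auto simp: I order_less_imp_le)
      ultimately show ?thesis by (simp add: I)
    qed
    moreover have "I \<subseteq> P" using P by (auto simp: I)
    ultimately show "I \<in> interval_closed_sets P"
      unfolding interval_closed_sets_def by blast
  next
    fix I assume I: "I \<in> interval_closed_sets P"
    then have sub: "I \<subseteq> P"
      and conv: "\<And>a b z. a \<in> I \<Longrightarrow> b \<in> I \<Longrightarrow> z \<in> P \<Longrightarrow> a < z \<Longrightarrow> z < b \<Longrightarrow> z \<in> I"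
      unfolding interval_closed_sets_def by blast+
    define J where "J = {y \<in> P. \<exists>x\<in>I. y \<le> x}"
    have IJ: "I \<subseteq> J" using sub by (auto simp: J_def)
    have J: "J \<in> order_ideals P"
    proof -
      have "y \<in> J" if "x \<in> J" "y \<in> P" "y \<le> x" for x y
      proof -
        obtain i where "i \<in> I" "x \<le> i" using \<open>x \<in> J\<close> by (auto simp: J_def)
        then have "y \<le> i" using order_trans[OF \<open>y \<le> x\<close>] by blast
        then show ?thesis using \<open>i \<in> I\<close> \<open>y \<in> P\<close> by (auto simp: J_def)
      qed
      moreover have "J \<subseteq> P" by (auto simp: J_def)
      ultimately show ?thesis unfolding order_ideals_def by blast
    qed
    have K: "J - I \<in> order_ideals P"
    proof -
      have "y \<in> J - I" if x: "x \<in> J - I" and y: "y \<in> P" "y \<le> x" for x y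
      proof -
        obtain i where i: "i \<in> I" "x \<le> i" and "x \<in> P" using x by (auto simp: J_def)
        have "y \<notin> I"
        proof
          assume "y \<in> I"
          then have "y < x" "x < i" using x y i by (auto simp: order_less_le)
          then show False using conv[of y i x] \<open>y \<in> I\<close> i \<open>x \<in> P\<close> x by blast
        qed
        moreover have "y \<in> J" using J x y by (auto simp: order_ideals_def)
        ultimately show ?thesis by blast
      qed
      moreover have "J - I \<subseteq> P" by (auto simp: J_def)
      ultimately show ?thesis unfolding order_ideals_def by blast
    qed
    have "x \<notin> J - I" if x: "x \<in> J" "\<forall>y\<in>J. \<not> x < y" for x
    proof -
      obtain i where "i \<in> I" "x \<le> i" using x by (auto simp: J_def)
      then have "x = i" using x IJ by (metis order_less_le subsetD)
      then show ?thesis using \<open>i \<in> I\<close> by simp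
    qed
    then have "(J - I, J) \<in> tight_ideal_pairs P"
      using J K unfolding tight_ideal_pairs_def by blast
    moreover have "(\<lambda>(K, J). J - K) (J - I, J) = I" using IJ by auto
    ultimately show "I \<in> (\<lambda>(K, J). J - K) ` tight_ideal_pairs P" by (metis imageI)
  qed
qed

section \<open>Order ideals of the triangle as lattice paths\<close>

text \<open>
  A word encodes the lattice path starting at \<open>0\<close> that goes up by one at each \<open>True\<close> and is flat at
  each \<open>False\<close>.
\<close>
definition height :: "bool list \<Rightarrow> nat \<Rightarrow> nat" where
  "height u k = count_list (take k u) True"

lemma height_0 [simp]: "height u 0 = 0"
  by (simp add: height_def)

lemma height_Suc: "k < length u \<Longrightarrow> height u (Suc k) = height u k + of_bool (u ! k)"
  by (simp add: height_def take_Suc_conv_app_nth)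

lemma height_Cons_Suc [simp]: "height (x # u) (Suc k) = of_bool x + height u k"
  by (simp add: height_def)

lemma height_le: "height u k \<le> k"
  using count_le_length[of "take k u" True] by (simp add: height_def)

text \<open>
  The element \<open>(a, b)\<close> lies in file number \<open>n - (b - a)\<close> of the triangle of size \<open>n\<close>, written
  \<open>n + a - b\<close> to avoid a nested truncated subtraction. Within its file it is element number \<open>a\<close>.
\<close>
definition ideal_below :: "bool list \<Rightarrow> (nat \<times> nat) set" where
  "ideal_below u =
     {(a, b). (a, b) \<in> minuscule_B (length u) \<and> a \<le> height u (length u + a - b)}"

lemma mem_ideal_below_iff:
  assumes "k \<le> length u"
  shows "(a, a + length u - k) \<in> ideal_below u \<longleftrightarrow> 1 \<le> a \<and> a \<le> height u k"
  using assms height_le[of u k] by (auto simp: ideal_below_def minuscule_B_def)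

lemma minuscule_B_file:
  assumes "(a, b) \<in> minuscule_B n"
  obtains k where "1 \<le> k" "k \<le> n" "a \<le> k" "1 \<le> a" "b = a + n - k"
proof
  show "1 \<le> n + a - b" "n + a - b \<le> n" "a \<le> n + a - b" "1 \<le> a" "b = a + n - (n + a - b)"
    using assms by (auto simp: minuscule_B_def)
qed

lemma finite_minuscule_B: "finite (minuscule_B n)"
  by (rule finite_subset[of _ "{..n} \<times> {..n}"]) (auto simp: minuscule_B_def)

text \<open>
  Moving from file \<open>k\<close> to a later file, elements below \<open>(a, b)\<close> have the same or a smaller index, and
  the path does not descend. Moving to an earlier file, each file passed lowers the index by at
  least one, while the path descends by at most one.
\<close>
lemma ideal_below_in_order_ideals: "ideal_below u \<in> order_ideals (minuscule_B (length u))"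
proof -
  have mono: "height u k \<le> height u (k + j)" if "k + j \<le> length u" for k j
    using that by (induction j) (auto simp: height_Suc)
  have lip: "height u (k + j) \<le> height u k + j" if "k + j \<le> length u" for k j
    using that by (induction j) (auto simp: height_Suc)
  have "(c, d) \<in> ideal_below u"
    if ab: "(a, b) \<in> ideal_below u" and cd: "(c, d) \<in> minuscule_B (length u)"
      and le: "c \<le> a" "d \<le> b" for a b c d
  proof -
    define k where "k = length u + a - b"
    define k' where "k' = length u + c - d"
    have ak: "a \<le> height u k" "a \<le> b" "b \<le> length u" "1 \<le> c" "c \<le> d" "d \<le> length u"
      using ab cd by (auto simp: ideal_below_def minuscule_B_def k_def)
    have "c \<le> height u k'"
    proof (cases "k \<le> k'")
      case True
      moreover have "k' \<le> length u" using ak by (simp add: k'_def)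
      ultimately have "height u k \<le> height u k'" using mono[of k "k' - k"] by simp
      then show ?thesis using ak le by linarith
    next
      case False
      have "k - k' \<le> a - c" using False ak le unfolding k_def k'_def by linarith
      moreover have "height u k \<le> height u k' + (k - k')"
        using lip[of k' "k - k'"] False ak by (auto simp: k_def)
      ultimately show ?thesis using ak le by linarith
    qed
    then show ?thesis using cd by (simp add: ideal_below_def k'_def)
  qed
  moreover have "ideal_below u \<subseteq> minuscule_B (length u)" by (auto simp: ideal_below_def)
  ultimately show ?thesis unfolding order_ideals_def by force
qed

lemma ideal_below_subset_iff:
  assumes "length v = length u"
  shows "ideal_below v \<subseteq> ideal_below u \<longleftrightarrow> (\<forall>k\<le>length u. height v k \<le> height u k)"
proof
  assume sub: "ideal_below v \<subseteq> ideal_below u"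
  show "\<forall>k\<le>length u. height v k \<le> height u k"
  proof (intro allI impI)
    fix k assume k: "k \<le> length u"
    show "height v k \<le> height u k"
      using mem_ideal_below_iff[of k v "height v k"] mem_ideal_below_iff[of k u "height v k"]
        k sub assms by (cases "height v k = 0") auto
  qed
next
  assume le: "\<forall>k\<le>length u. height v k \<le> height u k"
  show "ideal_below v \<subseteq> ideal_below u"
  proof clarify
    fix a b assume "(a, b) \<in> ideal_below v"
    moreover from this have "height v (length u + a - b) \<le> height u (length u + a - b)"
      using assms by (intro le[rule_format]) (auto simp: ideal_below_def minuscule_B_def)
    ultimately show "(a, b) \<in> ideal_below u"
      using assms by (simp add: ideal_below_def)
  qed
qed

lemma ideal_below_inject:
  assumes "length v = length u" and eq: "ideal_below v = ideal_below u"
  shows "v = u"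
proof (rule nth_equalityI[OF assms(1)])
  fix i assume i: "i < length v"
  have eq_height: "height v k = height u k" if k: "k \<le> length u" for k
  proof (rule antisym)
    show "height v k \<le> height u k"
      using ideal_below_subset_iff[OF assms(1)] eq k by blast
    show "height u k \<le> height v k"
      using ideal_below_subset_iff[OF assms(1)[symmetric]] eq k assms(1) by auto
  qed
  have "height v i + of_bool (v ! i) = height u i + of_bool (u ! i)"
    using eq_height[of "Suc i"] i assms(1) by (simp add: height_Suc)
  then show "v ! i = u ! i"
    using eq_height[of i] i assms(1) by (simp add: of_bool_eq_iff)
qed

text \<open>
  The heights are the numbers of elements of \<open>J\<close> in each file. They satisfy \<open>h k \<le> h (k + 1)\<close> because
  element \<open>a\<close> of file \<open>k\<close> covers element \<open>a\<close> of file \<open>k + 1\<close>, and \<open>h (k + 1) \<le> h k + 1\<close> because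
  element \<open>a + 1\<close> of file \<open>k + 1\<close> covers element \<open>a\<close> of file \<open>k\<close>.
\<close>
lemma order_ideal_eq_ideal_below:
  assumes "J \<in> order_ideals (minuscule_B n)"
  obtains u where "length u = n" "ideal_below u = J"
proof -
  have sub: "J \<subseteq> minuscule_B n"
    and ideal: "\<And>x y. x \<in> J \<Longrightarrow> y \<in> minuscule_B n \<Longrightarrow> y \<le> x \<Longrightarrow> y \<in> J"
    using assms unfolding order_ideals_def by blast+
  have down: "(c, d) \<in> J" if "(a, b) \<in> J" "1 \<le> c" "c \<le> d" "c \<le> a" "d \<le> b" for a b c d
    using ideal[OF that(1), of "(c, d)"] sub that by (auto simp: minuscule_B_def)
  define col where "col k = {a. (a, a + n - k) \<in> J}" for k
  define h where "h k = card (col k)" for k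
  have col_sub: "col k \<subseteq> {1..k}" if "k \<le> n" for k
    using sub that by (auto simp: col_def minuscule_B_def)
  have fin: "finite (col k)" if "k \<le> n" for k
    using col_sub[OF that] finite_subset by blast
  have col_down: "c \<in> col k" if "a \<in> col k" "1 \<le> c" "c \<le> a" "k \<le> n" for a c k
    using down[of a "a + n - k" c "c + n - k"] that by (auto simp: col_def)
  have col: "col k = {1..h k}" if k: "k \<le> n" for k
  proof (cases "col k = {}")
    case False
    define m where "m = Max (col k)"
    have m: "m \<in> col k" unfolding m_def by (rule Max_in[OF fin[OF k] False])
    have "a \<in> col k \<longleftrightarrow> a \<in> {1..m}" for a
    proof
      assume a: "a \<in> col k"
      then have "a \<le> m" unfolding m_def by (rule Max_ge[OF fin[OF k]])
      moreover have "1 \<le> a" using a col_sub[OF k] by auto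
      ultimately show "a \<in> {1..m}" by simp
    next
      assume "a \<in> {1..m}"
      then show "a \<in> col k" using col_down[OF m] k by simp
    qed
    then have "col k = {1..m}" by blast
    then show ?thesis by (simp add: h_def)
  qed (simp add: h_def)
  have h0: "h 0 = 0" using col_sub[of 0] by (simp add: h_def)
  have step: "h k \<le> h (Suc k) \<and> h (Suc k) \<le> Suc (h k)" if k: "k < n" for k
  proof
    have "col k \<subseteq> col (Suc k)"
    proof
      fix a assume "a \<in> col k"
      then show "a \<in> col (Suc k)"
        using down[of a "a + n - k" a "a + n - Suc k"] col_sub[of k] k by (auto simp: col_def)
    qed
    then show "h k \<le> h (Suc k)" using col[of k] col[of "Suc k"] k by auto
    show "h (Suc k) \<le> Suc (h k)"
    proof (rule ccontr)
      assume c: "\<not> ?thesis"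
      then have "Suc (Suc (h k)) \<in> col (Suc k)" using col[of "Suc k"] k by auto
      then have "Suc (h k) \<in> col k"
        using down[of "Suc (Suc (h k))" "Suc (Suc (h k)) + n - Suc k" "Suc (h k)" "Suc (h k) + n - k"]
          k by (auto simp: col_def)
      then show False using col[of k] k by auto
    qed
  qed
  define u where "u = map (\<lambda>k. h (Suc k) \<noteq> h k) [0..<n]"
  have len: "length u = n" by (simp add: u_def)
  have height: "height u k = h k" if "k \<le> n" for k
    using that
  proof (induction k)
    case (Suc k)
    then show ?case using step[of k] by (auto simp: height_Suc len u_def)
  qed (simp add: h0)
  have "x \<in> ideal_below u \<longleftrightarrow> x \<in> J" for x
  proof -
    obtain a b where x: "x = (a, b)" by force
    show ?thesis
    proof (cases "x \<in> minuscule_B n")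
      case True
      then obtain k where k: "k \<le> n" "b = a + n - k"
        using minuscule_B_file x by metis
      then have "x \<in> ideal_below u \<longleftrightarrow> a \<in> col k"
        using mem_ideal_below_iff[of k u a] len col height x by auto
      then show ?thesis using x k by (simp add: col_def)
    next
      case False
      then show ?thesis using sub len by (auto simp: ideal_below_def x)
    qed
  qed
  then show ?thesis using that[of u] len by blast
qed

text \<open>
  The element number \<open>a\<close> of file \<open>k + 1\<close> is covered by at most two elements: number \<open>a\<close> of file \<open>k\<close> and
  number \<open>a + 1\<close> of file \<open>k + 2\<close>. A file being a chain, a maximal element of an ideal is the top one
  of its file; the first cover is missing from the ideal iff the path has just gone up, and the second iff the path
  then stays flat or ends. The maximal elements are thus the peaks of the path, and such an element
  avoids the ideal of \<open>v\<close> iff the path of \<open>v\<close> is strictly lower there.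
\<close>
lemma tight_iff_peaks:
  assumes len: "length v = length u"
  shows "(\<forall>x\<in>ideal_below u. (\<forall>y\<in>ideal_below u. \<not> x < y) \<longrightarrow> x \<notin> ideal_below v) \<longleftrightarrow>
    (\<forall>k<length u. u ! k \<and> (Suc k < length u \<longrightarrow> \<not> u ! Suc k) \<longrightarrow> height v (Suc k) < height u (Suc k))"
  (is "?tight \<longleftrightarrow> ?peaks")
proof
  assume tight: ?tight
  show ?peaks
  proof (intro allI impI, elim conjE)
    fix k assume k: "k < length u" and up: "u ! k" and down: "Suc k < length u \<longrightarrow> \<not> u ! Suc k"
    define a where "a = height u (Suc k)"
    have a: "a = Suc (height u k)" using k up by (simp add: a_def height_Suc)
    define b where "b = a + length u - Suc k"
    have x: "(a, b) \<in> ideal_below u"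
      using mem_ideal_below_iff[of "Suc k" u a] k a by (auto simp: a_def b_def)
    have "\<not> (a, b) < y" if y: "y \<in> ideal_below u" for y
    proof
      assume "(a, b) < y"
      moreover obtain c d where cd: "y = (c, d)" by force
      ultimately have le: "a \<le> c" "b \<le> d" "Suc a \<le> c \<or> Suc b \<le> d"
        by (auto simp: less_prod_def less_eq_prod_def)
      have "b \<ge> a" using k by (simp add: b_def)
      have P: "(c, d) \<in> minuscule_B (length u)" using y cd by (auto simp: ideal_below_def)
      note ideal = ideal_below_in_order_ideals[of u]
      from le(3) show False
      proof
        assume "Suc b \<le> d"
        then have "(a, Suc b) \<in> ideal_below u"
          using ideal y cd le P a \<open>b \<ge> a\<close> by (force simp: order_ideals_def minuscule_B_def)
        moreover have "Suc b = a + length u - k" using k by (simp add: b_def)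
        ultimately show False using mem_ideal_below_iff[of k u a] k a by simp
      next
        assume c: "Suc a \<le> c"
        show False
        proof (cases "Suc k < length u")
          case True
          then have "Suc a \<le> b" by (simp add: b_def)
          then have "(Suc a, b) \<in> ideal_below u"
            using ideal y cd le c P by (force simp: order_ideals_def minuscule_B_def)
          moreover have "b = Suc a + length u - Suc (Suc k)" using True by (simp add: b_def)
          ultimately have "Suc a \<le> height u (Suc (Suc k))"
            using mem_ideal_below_iff[of "Suc (Suc k)" u "Suc a"] True by simp
          then show False using height_Suc[of "Suc k" u] True down by (simp add: a_def)
        next
          case False
          then have "Suc k = length u" using k by simp
          then have "b = a" by (simp add: b_def)
          have "Suc a \<le> d" using c P by (simp add: minuscule_B_def)
          then have "(Suc a, Suc a) \<in> ideal_below u"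
            using ideal y cd c P by (force simp: order_ideals_def minuscule_B_def)
          then show False
            using mem_ideal_below_iff[of "length u" u "Suc a"] \<open>Suc k = length u\<close>
            by (simp add: a_def)
        qed
      qed
    qed
    then have "(a, b) \<notin> ideal_below v" using tight x by blast
    then show "height v (Suc k) < height u (Suc k)"
      using mem_ideal_below_iff[of "Suc k" v a] len k a by (auto simp: b_def simp flip: a_def)
  qed
next
  assume peaks: ?peaks
  show ?tight
  proof (intro ballI impI)
    fix x assume x: "x \<in> ideal_below u" and max: "\<forall>y\<in>ideal_below u. \<not> x < y"
    obtain a b where ab: "x = (a, b)" by force
    have P: "(a, b) \<in> minuscule_B (length u)" using x ab by (auto simp: ideal_below_def)
    then obtain k' where k': "1 \<le> k'" "k' \<le> length u" "1 \<le> a" "b = a + length u - k'"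
      using minuscule_B_file by metis
    then obtain k where kk: "k' = Suc k" by (cases k') auto
    have k: "k < length u" "b = a + length u - Suc k" using k' kk by auto
    have not_mem: "(c, d) \<notin> ideal_below u" if "a \<le> c" "b \<le> d" "a < c \<or> b < d" for c d
      using max that ab by (auto simp: less_prod_def less_eq_prod_def)
    have le: "a \<le> height u (Suc k)" using mem_ideal_below_iff[of "Suc k" u a] x ab k by simp
    have "(Suc a, Suc a + length u - Suc k) \<notin> ideal_below u"
      using not_mem k by simp
    then have "\<not> Suc a \<le> height u (Suc k)"
      using mem_ideal_below_iff[of "Suc k" u "Suc a"] k by simp
    then have eq: "a = height u (Suc k)" using le by simp
    have "(a, a + length u - k) \<notin> ideal_below u" using not_mem k by simp
    then have "\<not> a \<le> height u k" using mem_ideal_below_iff[of k u a] k k' by simp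
    then have up: "u ! k" using eq height_Suc[of k u] k by (auto split: if_splits)
    have down: "\<not> u ! Suc k" if s: "Suc k < length u"
    proof -
      have "(Suc a, Suc a + length u - Suc (Suc k)) \<notin> ideal_below u" using not_mem k s by simp
      then have "\<not> Suc a \<le> height u (Suc (Suc k))"
        using mem_ideal_below_iff[of "Suc (Suc k)" u "Suc a"] s by simp
      then show ?thesis using height_Suc[of "Suc k" u] s eq by auto
    qed
    have "height v (Suc k) < a" using peaks k up down eq by blast
    then show "x \<notin> ideal_below v" using mem_ideal_below_iff[of "Suc k" v a] ab k len by simp
  qed
qed

section \<open>Counting pairs of paths\<close>

text \<open>
  An automaton reading the upper and the lower word of a tight pair together. Its state consists of
  the current distance \<open>d\<close> of the two paths and of whether the last step \<open>p\<close> of the upper path was up.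
  A peak is detected one step late, when the next upper step is flat or the words end; the distance
  required to be positive is the one before that step. At distance \<open>0\<close> the step
  that is flat above and up below is excluded, so the subtraction never truncates.
\<close>
fun admissible :: "nat \<Rightarrow> bool \<Rightarrow> (bool \<times> bool) list \<Rightarrow> bool" where
  "admissible d p [] = (p \<longrightarrow> 0 < d)"
| "admissible d p ((x, y) # w) =
     ((p \<and> \<not> x \<longrightarrow> 0 < d) \<and> (y \<longrightarrow> x \<or> 0 < d) \<and> admissible (d + of_bool x - of_bool y) x w)"

lemma all_le_iff_0_Suc: "(\<forall>k\<le>n. Q k) \<longleftrightarrow> Q 0 \<and> (\<forall>k<n. Q (Suc k))"
  by (metis Suc_leI le0 less_eq_Suc_le not0_implies_Suc)

text \<open>
  Prefixing the upper word with \<open>p\<close> lets position \<open>k\<close> hold the step that leads to height number \<open>k\<close>,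
  which treats a peak at the starting point like all others.
\<close>
lemma admissible_iff:
  "admissible d p w \<longleftrightarrow>
     (\<forall>k\<le>length w. height (map snd w) k \<le> d + height (map fst w) k) \<and>
     (\<forall>k\<le>length w. (p # map fst w) ! k \<and> (k < length w \<longrightarrow> \<not> map fst w ! k) \<longrightarrow>
        height (map snd w) k < d + height (map fst w) k)"
proof (induction w arbitrary: d p)
  case (Cons z w)
  obtain x y where z: "z = (x, y)" by force
  have bal: "(y \<longrightarrow> x \<or> 0 < d) \<and> (\<forall>k\<le>length w. height (map snd w) k \<le> d + of_bool x - of_bool y + height (map fst w) k)
    \<longleftrightarrow> (\<forall>k\<le>length w. of_bool y + height (map snd w) k \<le> d + (of_bool x + height (map fst w) k))"
    (is "?A \<and> ?B \<longleftrightarrow> ?C")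
  proof -
    have "?C \<Longrightarrow> ?A" by (drule spec[of _ 0]) (auto simp: of_bool_def split: if_splits)
    moreover have "?A \<Longrightarrow> ?B \<longleftrightarrow> ?C" by (auto simp: of_bool_def)
    ultimately show ?thesis by blast
  qed
  let ?turn = "\<lambda>k. (x # map fst w) ! k \<and> (k < length w \<longrightarrow> \<not> map fst w ! k)"
  have strict: "(\<forall>k\<le>length w. ?turn k \<longrightarrow>
        height (map snd w) k < d + of_bool x - of_bool y + height (map fst w) k) \<longleftrightarrow>
      (\<forall>k\<le>length w. ?turn k \<longrightarrow>
        of_bool y + height (map snd w) k < d + (of_bool x + height (map fst w) k))"
    if "y \<longrightarrow> x \<or> 0 < d"
  proof -
    have "(height (map snd w) k < d + of_bool x - of_bool y + height (map fst w) k) \<longleftrightarrow>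
        (of_bool y + height (map snd w) k < d + (of_bool x + height (map fst w) k))" for k
      using that by (auto simp: of_bool_def)
    then show ?thesis by simp
  qed
  have "admissible d p (z # w) \<longleftrightarrow> (p \<and> \<not> x \<longrightarrow> 0 < d) \<and>
      (\<forall>k\<le>length w. of_bool y + height (map snd w) k \<le> d + (of_bool x + height (map fst w) k)) \<and>
      (\<forall>k\<le>length w. ?turn k \<longrightarrow>
        of_bool y + height (map snd w) k < d + (of_bool x + height (map fst w) k))"
    unfolding z admissible.simps Cons.IH using bal strict by blast
  also have "\<dots> \<longleftrightarrow>
      (\<forall>k\<le>length (z # w). height (map snd (z # w)) k \<le> d + height (map fst (z # w)) k) \<and>
      (\<forall>k\<le>length (z # w). (p # map fst (z # w)) ! k \<and>
        (k < length (z # w) \<longrightarrow> \<not> map fst (z # w) ! k) \<longrightarrow>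
        height (map snd (z # w)) k < d + height (map fst (z # w)) k)"
    unfolding all_le_iff_0_Suc[of "length (z # w)"]
    by (simp add: z less_Suc_eq_le Suc_le_eq conj_ac)
  finally show ?case .
qed simp

definition num_admissible :: "nat \<Rightarrow> bool \<Rightarrow> nat \<Rightarrow> nat" where
  "num_admissible d p n = card {w. length w = n \<and> admissible d p w}"

lemma card_interval_closed_sets_minuscule_B:
  "card (interval_closed_sets (minuscule_B n)) = num_admissible 0 False n"
proof -
  let ?W = "{w. length w = n \<and> admissible 0 False w}"
  let ?f = "\<lambda>w :: (bool \<times> bool) list. (ideal_below (map snd w), ideal_below (map fst w))"
  have iff: "?f w \<in> tight_ideal_pairs (minuscule_B n) \<longleftrightarrow> admissible 0 False w"
    if len: "length w = n" for w
  proof -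
    have "?f w \<in> tight_ideal_pairs (minuscule_B n) \<longleftrightarrow>
        ideal_below (map snd w) \<subseteq> ideal_below (map fst w) \<and>
        (\<forall>x\<in>ideal_below (map fst w). (\<forall>y\<in>ideal_below (map fst w). \<not> x < y) \<longrightarrow>
          x \<notin> ideal_below (map snd w))"
      using len ideal_below_in_order_ideals[of "map snd w"]
        ideal_below_in_order_ideals[of "map fst w"]
      by (simp add: tight_ideal_pairs_def)
    also have "\<dots> \<longleftrightarrow> admissible 0 False w"
    proof -
      have "(\<forall>k\<le>length w. (False # map fst w) ! k \<and> (k < length w \<longrightarrow> \<not> map fst w ! k) \<longrightarrow>
            height (map snd w) k < 0 + height (map fst w) k) \<longleftrightarrow>
          (\<forall>k<length w. map fst w ! k \<and> (Suc k < length w \<longrightarrow> \<not> map fst w ! Suc k) \<longrightarrow>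
            height (map snd w) (Suc k) < height (map fst w) (Suc k))"
        by (subst all_le_iff_0_Suc) simp
      then show ?thesis
        unfolding admissible_iff
        by (simp only: ideal_below_subset_iff tight_iff_peaks length_map add_0)
    qed
    finally show ?thesis .
  qed
  have "bij_betw ?f ?W (tight_ideal_pairs (minuscule_B n))"
  proof (rule bij_betw_imageI)
    show "inj_on ?f ?W"
    proof (rule inj_onI)
      fix w w' assume w: "w \<in> ?W" "w' \<in> ?W" and eq: "?f w = ?f w'"
      have "map snd w = map snd w'" using w eq by (intro ideal_below_inject) simp_all
      moreover have "map fst w = map fst w'" using w eq by (intro ideal_below_inject) simp_all
      ultimately show "w = w'" by (metis zip_map_fst_snd)
    qed
    show "?f ` ?W = tight_ideal_pairs (minuscule_B n)"
    proof (intro equalityI subsetI)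
      fix q assume "q \<in> ?f ` ?W"
      then obtain w where "w \<in> ?W" "q = ?f w" by (rule imageE)
      then show "q \<in> tight_ideal_pairs (minuscule_B n)" using iff[of w] by simp
    next
      fix q assume q: "q \<in> tight_ideal_pairs (minuscule_B n)"
      obtain K J where KJ: "q = (K, J)" by force
      have K: "K \<in> order_ideals (minuscule_B n)" and J: "J \<in> order_ideals (minuscule_B n)"
        using q KJ by (simp_all add: tight_ideal_pairs_def)
      obtain v where v: "length v = n" "ideal_below v = K"
        using order_ideal_eq_ideal_below[OF K] .
      obtain u where u: "length u = n" "ideal_below u = J"
        using order_ideal_eq_ideal_below[OF J] .
      have f: "?f (zip u v) = q" and len: "length (zip u v) = n" using KJ u v by simp_all
      have "zip u v \<in> ?W" using iff[OF len] q len unfolding f by simp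
      then show "q \<in> ?f ` ?W" unfolding f[symmetric] by (rule imageI)
    qed
  qed
  from bij_betw_same_card[OF this]
    bij_betw_same_card[OF bij_betw_tight_ideal_pairs[OF finite_minuscule_B]]
  show ?thesis by (simp only: num_admissible_def)
qed

lemma num_admissible_0: "num_admissible d p 0 = of_bool (p \<longrightarrow> 0 < d)"
proof -
  have "{w. length w = 0 \<and> admissible d p w} = (if p \<longrightarrow> 0 < d then {[]} else {})" by auto
  then show ?thesis by (simp add: num_admissible_def)
qed

text \<open>
  The summands are the possible first steps: both flat, both up, widening, narrowing. The first one is
  excluded by a peak where the paths meet, the last one by the paths being nested.
\<close>
lemma num_admissible_Suc:
  "num_admissible d p (Suc n) =
     (if p \<and> d = 0 then 0 else num_admissible d False n) + num_admissible d True n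
       + num_admissible (Suc d) True n + (if d = 0 then 0 else num_admissible (d - 1) False n)"
proof -
  let ?S = "{(x, y). (p \<and> \<not> x \<longrightarrow> 0 < d) \<and> (y \<longrightarrow> x \<or> 0 < d)}"
  let ?A = "\<lambda>x y. {w. length w = n \<and> admissible (d + of_bool x - of_bool y) x w}"
  let ?N = "\<lambda>x y. if (x, y) \<in> ?S then num_admissible (d + of_bool x - of_bool y) x n else 0"
  have fin: "finite (?A x y)" for x y
    by (rule finite_subset[OF _ finite_lists_length_eq[OF finite_UNIV, of n]]) auto
  have "{w. length w = Suc n \<and> admissible d p w} = (\<Union>z\<in>?S. (#) z ` ?A (fst z) (snd z))"
  proof (rule set_eqI)
    fix w
    show "w \<in> {w. length w = Suc n \<and> admissible d p w} \<longleftrightarrow>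
        w \<in> (\<Union>z\<in>?S. (#) z ` ?A (fst z) (snd z))"
      by (cases w) (auto simp: image_iff)
  qed
  then have "num_admissible d p (Suc n) = card (\<Union>z\<in>?S. (#) z ` ?A (fst z) (snd z))"
    by (simp only: num_admissible_def)
  also have "\<dots> = (\<Sum>z\<in>?S. card ((#) z ` ?A (fst z) (snd z)))"
    using fin by (intro card_UN_disjoint) auto
  also have "\<dots> = (\<Sum>z\<in>?S. num_admissible (d + of_bool (fst z) - of_bool (snd z)) (fst z) n)"
    unfolding num_admissible_def by (intro sum.cong refl card_image) simp
  also have "\<dots> = (\<Sum>z\<in>UNIV. ?N (fst z) (snd z))"
    by (rule sum.mono_neutral_cong_left) auto
  also have "\<dots> = (\<Sum>x\<in>UNIV. \<Sum>y\<in>UNIV. ?N x y)"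
    by (simp only: sum.cartesian_product UNIV_Times_UNIV case_prod_unfold)
  also have "\<dots> = ?N False False + ?N False True + ?N True False + ?N True True"
    by (simp only: UNIV_bool sum.insert sum.empty finite.intros) simp
  finally show ?thesis by auto
qed

text \<open>
  At positive distance every peak is allowed, whatever the last upper step has been.
\<close>
lemma num_admissible_pos:
  assumes "0 < d"
  shows "num_admissible d p n = num_admissible d False n"
  using assms by (cases n) (simp_all add: num_admissible_0 num_admissible_Suc)

lemma num_admissible_zero_False_Suc:
  "num_admissible 0 False (Suc n) =
     num_admissible 0 False n + num_admissible 0 True n + num_admissible 1 False n"
  using num_admissible_pos[of 1 True n] by (simp add: num_admissible_Suc)

lemma num_admissible_zero_True_Suc:
  "num_admissible 0 True (Suc n) = num_admissible 0 True n + num_admissible 1 False n"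
  using num_admissible_pos[of 1 True n] by (simp add: num_admissible_Suc)

lemma num_admissible_Suc_Suc:
  "num_admissible (Suc d) False (Suc n) =
     num_admissible (Suc (Suc d)) False n + 2 * num_admissible (Suc d) False n
       + num_admissible d False n"
  using num_admissible_pos[of "Suc d" True n] num_admissible_pos[of "Suc (Suc d)" True n]
  by (simp add: num_admissible_Suc)

section \<open>Generating functions\<close>

definition gf :: "nat \<Rightarrow> bool \<Rightarrow> real fps" where
  "gf d p = Abs_fps (\<lambda>n. real (num_admissible d p n))"

lemma fps_eq_plus_X_mult:
  fixes f g e :: "'a::semiring_1 fps"
  assumes "fps_nth f 0 = fps_nth e 0"
    and "\<And>n. fps_nth f (Suc n) = fps_nth e (Suc n) + fps_nth g n"
  shows "f = e + fps_X * g"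
proof (rule fps_ext)
  fix n
  show "fps_nth f n = fps_nth (e + fps_X * g) n"
    using assms by (cases n) auto
qed

lemma gf_zero_False: "gf 0 False = 1 + fps_X * (gf 0 False + gf 0 True + gf 1 False)"
  by (rule fps_eq_plus_X_mult)
    (simp_all add: gf_def num_admissible_0 num_admissible_zero_False_Suc)

lemma gf_zero_True: "gf 0 True = fps_X * (gf 0 True + gf 1 False)"
  by (rule fps_eq_plus_X_mult[of _ 0, unfolded add_0])
    (simp_all add: gf_def num_admissible_0 num_admissible_zero_True_Suc)

lemma gf_Suc:
  "gf (Suc d) False = 1 + fps_X * (gf (Suc (Suc d)) False + 2 * gf (Suc d) False + gf d False)"
  by (rule fps_eq_plus_X_mult)
    (simp_all add: gf_def num_admissible_0 num_admissible_Suc_Suc numeral_fps_const)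

text \<open>
  Solutions of the recurrence are determined by the term at \<open>0\<close> alone, although it has order two: the
  factor \<open>x\<close> makes coefficient \<open>n + 1\<close> of every later term depend on coefficients \<open>n\<close> only.
\<close>
lemma fps_recurrence_zero:
  fixes D :: "nat \<Rightarrow> 'a::comm_ring_1 fps"
  assumes "D 0 = 0" and rec: "\<And>d. D (Suc d) = fps_X * (D (Suc (Suc d)) + 2 * D (Suc d) + D d)"
  shows "D d = 0"
proof -
  have "\<forall>d. fps_nth (D d) n = 0" for n
  proof (induction n)
    case 0
    show ?case
    proof
      fix d show "fps_nth (D d) 0 = 0"
      proof (cases d)
        case (Suc e)
        show ?thesis unfolding \<open>d = Suc e\<close> by (subst rec) simp
      qed (simp add: assms(1))
    qed
  next
    case IH: (Suc n)
    show ?case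
    proof
      fix d show "fps_nth (D d) (Suc n) = 0"
      proof (cases d)
        case (Suc e)
        show ?thesis unfolding \<open>d = Suc e\<close>
          by (subst rec) (simp add: IH numeral_fps_const)
      qed (simp add: assms(1))
    qed
  qed
  then show ?thesis by (simp add: fps_eq_iff)
qed

text \<open>
  The sequence \<open>gf d False\<close> coincides with \<open>c + r ^ d * (gf 0 False - c)\<close>, where \<open>c = 1 / s\<^sup>2\<close> is the
  constant solution and \<open>r = (1 - s) / (1 + s)\<close> the characteristic root: both sequences solve the same
  recurrence and agree at \<open>0\<close>. The claim is the case \<open>d = 1\<close> with denominators cleared.
\<close>
lemma gf_one_eq:
  fixes s :: "real fps"
  assumes s2: "s ^ 2 = 1 - 4 * fps_X" and s0: "fps_nth s 0 = 1"
  shows "s * (1 + s) * gf 1 False = 2 + s * (1 - s) * gf 0 False"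
proof -
  let ?i = "inverse (1 + s)" and ?j = "inverse s"
  define r where "r = (1 - s) * ?i"
  have i: "?i * (1 + s) = 1" and j: "?j * s = 1"
    using s0 by (simp_all add: inverse_mult_eq_1)
  have r: "r * (1 + s) = 1 - s" using i by (simp add: r_def mult.assoc)
  have X: "4 * fps_X = 1 - s ^ 2" using s2 by simp
  \<comment> \<open>Since \<open>4 x = (1 - s) (1 + s)\<close> and \<open>(1 + s) (1 + r) = 2\<close>.\<close>
  have ker: "r = fps_X * (r ^ 2 + 2 * r + 1)"
  proof -
    have "4 * (fps_X * (r ^ 2 + 2 * r + 1)) = (1 - s ^ 2) * (1 + r) ^ 2"
      unfolding X[symmetric] by (simp add: power2_eq_square algebra_simps)
    also have "\<dots> = (1 - s) * ((1 + s) * (1 + r)) * (1 + r)"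
      by (simp add: power2_eq_square algebra_simps)
    also have "(1 + s) * (1 + r) = 2" using r by (simp add: algebra_simps)
    also have "(1 - s) * 2 * (1 + r) = 2 * r * ((1 + s) * (1 + r))"
      unfolding r[symmetric] by (simp add: algebra_simps)
    also have "(1 + s) * (1 + r) = 2" using r by (simp add: algebra_simps)
    finally show ?thesis by simp
  qed
  define c where "c = ?j ^ 2"
  have c: "c = 1 + 4 * fps_X * c"
  proof -
    have "c * s ^ 2 = 1" using j by (simp add: c_def flip: power_mult_distrib)
    then show ?thesis unfolding s2 by (simp add: algebra_simps)
  qed
  define D where "D d = gf d False - (c + r ^ d * (gf 0 False - c))" for d
  have "D 1 = 0"
  proof (rule fps_recurrence_zero)
    show "D 0 = 0" by (simp add: D_def)
    fix d
    have "D (Suc d) = 1 + fps_X * (gf (Suc (Suc d)) False + 2 * gf (Suc d) False + gf d False)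
        - ((1 + 4 * fps_X * c) + r ^ d * (fps_X * (r ^ 2 + 2 * r + 1)) * (gf 0 False - c))"
      unfolding D_def using gf_Suc[of d] c ker by (metis power_Suc2)
    also have "\<dots> = fps_X * (D (Suc (Suc d)) + 2 * D (Suc d) + D d)"
      by (simp add: D_def power2_eq_square algebra_simps)
    finally show "D (Suc d) = fps_X * (D (Suc (Suc d)) + 2 * D (Suc d) + D d)" .
  qed
  then have g1: "gf 1 False = c + r * (gf 0 False - c)" by (simp add: D_def)
  have "s * (1 + s) * gf 1 False
      = s * c * ((1 + s) - r * (1 + s)) + s * (r * (1 + s)) * gf 0 False"
    unfolding g1 by (simp add: algebra_simps)
  also have "\<dots> = s * c * (2 * s) + s * (1 - s) * gf 0 False"
    unfolding r by simp
  also have "s * c * (2 * s) = 2"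
  proof -
    have "s * c * (2 * s) = 2 * (?j * s) * (?j * s)"
      by (simp add: c_def power2_eq_square algebra_simps)
    then show ?thesis by (simp only: j mult_1_right)
  qed
  finally show ?thesis .
qed

theorem theorem3p9:
  shows "Abs_fps (\<lambda>n. real (card (interval_closed_sets (minuscule_B n)))) =
    (4 - 10 * fps_X + 8 * fps_X ^ 2) /
    (2 - 11 * fps_X + 14 * fps_X ^ 2 - 8 * fps_X ^ 3 + (2 - 3 * fps_X) * sqrt_1_minus_4x)"
proof -
  define x :: "real fps" where "x = fps_X"
  define s where "s = sqrt_1_minus_4x"
  define F where "F = gf 0 False"
  define N where "N = 4 - 10 * x + 8 * x ^ 2"
  define Q where "Q = 2 - 11 * x + 14 * x ^ 2 - 8 * x ^ 3 + (2 - 3 * x) * s"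
  define A where "A = s * ((1 - x) ^ 2 * (1 + s) - x * (1 - s))"
  have s2: "s * s = 1 - 4 * x" and s0: "fps_nth s 0 = 1"
    using sqrt_1_minus_4x_square sqrt_1_minus_4x_nth_0 by (simp_all add: s_def x_def power2_eq_square)
  have G1: "s * (1 + s) * gf 1 False = 2 + s * (1 - s) * F"
    using gf_one_eq[of s] s2 s0 by (simp add: F_def x_def power2_eq_square)
  have "(1 - x) ^ 2 * F = (1 - x) * (1 + x * gf 1 False) + x * ((1 - x) * gf 0 True)"
    using gf_zero_False unfolding F_def x_def by algebra
  also have "(1 - x) * gf 0 True = x * gf 1 False"
    using gf_zero_True unfolding x_def by algebra
  finally have F: "(1 - x) ^ 2 * F = 1 - x + x * gf 1 False"
    by (simp add: algebra_simps)
  \<comment> \<open>Eliminating \<open>G\<^sub>1\<close> leaves one equation for \<open>F\<close>, linear with coefficients in \<open>x\<close> and \<open>s\<close>.\<close>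
  have AF: "A * F = (1 - x) * (s * (1 + s)) + 2 * x"
    using F G1 unfolding A_def by algebra
  \<comment> \<open>The two fractions for \<open>F\<close> agree modulo \<open>s\<^sup>2 = 1 - 4 x\<close>.\<close>
  have "A * (F * Q) = A * N"
    using AF s2 unfolding A_def N_def Q_def by algebra
  moreover have "fps_nth A 0 \<noteq> 0" by (simp add: A_def s0 x_def)
  then have "A \<noteq> 0" by auto
  ultimately have "F * Q = N" by simp
  moreover have "fps_nth Q 0 \<noteq> 0" by (simp add: Q_def s0 x_def)
  then have "Q \<noteq> 0" by auto
  ultimately have "F = N / Q" by (metis nonzero_mult_div_cancel_right)
  moreover have "Abs_fps (\<lambda>n. real (card (interval_closed_sets (minuscule_B n)))) = F"
    by (simp add: F_def gf_def card_interval_closed_sets_minuscule_B)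
  ultimately show ?thesis by (simp add: N_def Q_def x_def s_def)
qed

end
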